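(* Let $a<b$ be real numbers, let $r$ be a positive continuous function on the interval $(a,b)$ and let $p$ be a positive integer. Then for all measurable functions $f\ge 0$ on $(a,b)$ such that all integrals below exist and are finite, $$\int_a^b r(x)\left(\int_x^b f(t)\,dt\right)^{p+1}dx\le (b-a)^p\,\sup_{a<x<b}\left(\int_a^x r(t)\,dt\right)\int_a^b (f(x))^{p+1}\,dx.$$
   Context: Standing assumption: all functions are measurable and all the integrals appearing in the inequality (including $\int_a^x r$ and $\int_x^b f$ for $x\in(a,b)$) exist and are finite. The supremum is taken in $[0,+\infty]$, with $0\cdot\infty=0$. *)

theory Defs
  imports "HOL-Analysis.Analysis"
begin

end

theory Submission
  imports Defs "HOL-Real_Asymp.Real_Asymp"
begin

text \<open>
  Jensen's inequality on \<open>(x, b)\<close> gives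
  \<open>(\<integral>\<^sub>x\<^sup>b f)\<^sup>p\<^sup>+\<^sup>1 \<le> (b - x)\<^sup>p \<integral>\<^sub>x\<^sup>b f\<^sup>p\<^sup>+\<^sup>1 \<le> (b - a)\<^sup>p \<integral>\<^sub>a\<^sup>b f\<^sup>p\<^sup>+\<^sup>1\<close>, a bound that does not depend on \<open>x\<close>.
  Multiplying by \<open>r x\<close> and integrating leaves the factor \<open>\<integral>\<^sub>a\<^sup>b r\<close>, which is the supremum
  by monotone convergence. With extended nonnegative integrals this needs no case
  distinction on whether the supremum is finite.
\<close>

text \<open>Convexity: the graph of \<open>t ^ Suc n\<close> lies above its tangent at
  \<open>m\<close>. In the induction step, the hypothesis times \<open>t\<close> leaves a gap of
  exactly \<open>(real n + 1) * m ^ n * (t - m)\<close> times \<open>t - m\<close>, which is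
  nonnegative.\<close>

lemma power_Suc_above_tangent:
  fixes t m :: real
  assumes "0 \<le> t" "0 \<le> m"
  shows "(real n + 1) * m ^ n * t \<le> t ^ Suc n + real n * m ^ Suc n"
proof (induction n)
  case 0
  then show ?case by simp
next
  case (Suc n)
  have "t * ((real n + 1) * m ^ n * t) \<le> t * (t ^ Suc n + real n * m ^ Suc n)"
    using Suc assms by (intro mult_left_mono) auto
  moreover have "0 \<le> (real n + 1) * m ^ n * (t - m)\<^sup>2"
    using assms by simp
  ultimately show ?case
    by (simp add: algebra_simps power2_eq_square)
qed

text \<open>Jensen's inequality, obtained by integrating the tangent inequality with the tangent
  taken at the mean value of \<open>f\<close> over the interval.\<close>

lemma set_integral_power_Suc_le:
  fixes f :: "real \<Rightarrow> real"
  assumes "x < b"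
    and nonneg: "\<And>t. t \<in> {x<..<b} \<Longrightarrow> 0 \<le> f t"
    and f: "set_integrable lebesgue {x<..<b} f"
    and fp: "set_integrable lebesgue {x<..<b} (\<lambda>t. f t ^ Suc n)"
  shows "(LINT t:{x<..<b}|lebesgue. f t) ^ Suc n
    \<le> (b - x) ^ n * (LINT t:{x<..<b}|lebesgue. f t ^ Suc n)"
proof -
  define L where "L = b - x"
  define F where "F = (LINT t:{x<..<b}|lebesgue. f t)"
  define I where "I = (LINT t:{x<..<b}|lebesgue. f t ^ Suc n)"
  define m where "m = F / L"
  have L: "0 < L" using assms(1) by (simp add: L_def)
  have F: "0 \<le> F"
    unfolding F_def set_lebesgue_integral_def
    by (rule integral_nonneg_AE) (use nonneg in \<open>auto simp: indicator_def\<close>)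
  have m: "0 \<le> m" using L F by (simp add: m_def)
  have c: "set_integrable lebesgue {x<..<b} (\<lambda>t. real n * m ^ Suc n)"
    unfolding set_integrable_def by (simp add: lmeasurable_iff_integrable[symmetric] integrable_mult_left)
  have "(LINT t:{x<..<b}|lebesgue. (real n + 1) * m ^ n * f t)
      \<le> (LINT t:{x<..<b}|lebesgue. f t ^ Suc n + real n * m ^ Suc n)"
    using f fp c nonneg m
    by (intro set_integral_mono set_integral_add power_Suc_above_tangent set_integrable_mult_right) auto
  also have "\<dots> = I + (LINT t:{x<..<b}|lebesgue. real n * m ^ Suc n)"
    unfolding I_def by (rule set_integral_add(2)[OF fp c])
  also have "(LINT t:{x<..<b}|lebesgue. real n * m ^ Suc n) = L * (real n * m ^ Suc n)"
    using assms(1) by (simp add: set_lebesgue_integral_def L_def)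
  finally have "(real n + 1) * m ^ n * F \<le> I + L * (real n * m ^ Suc n)"
    by (simp add: F_def)
  \<comment> \<open>With the mean as tangent point the left side becomes
    \<open>(real n + 1) * L * m ^ Suc n\<close>, so \<open>real n\<close> of these copies cancel and
    one remains below \<open>I\<close>.\<close>
  moreover have "F = L * m" using L by (simp add: m_def)
  ultimately have "L * m ^ Suc n \<le> I"
    by (simp add: algebra_simps)
  then have "L ^ n * (L * m ^ Suc n) \<le> L ^ n * I"
    using L by (intro mult_left_mono) auto
  also have "L ^ n * (L * m ^ Suc n) = F ^ Suc n"
    using \<open>F = L * m\<close> by (simp add: power_mult_distrib)
  finally show ?thesis by (simp add: F_def I_def L_def)
qed

text \<open>Monotone convergence along a sequence increasing to \<open>b\<close>. Integrability is
  assumed only on each \<open>{a<..<x}\<close>, so the left side may be infinite; the supremum is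
  then infinite too.\<close>

lemma nn_integral_le_SUP_set_integral:
  fixes r :: "real \<Rightarrow> real"
  assumes "a < b"
    and nonneg: "\<And>x. x \<in> {a<..<b} \<Longrightarrow> 0 \<le> r x"
    and r: "\<And>x. x \<in> {a<..<b} \<Longrightarrow> set_integrable lebesgue {a<..<x} r"
  shows "(\<integral>\<^sup>+x\<in>{a<..<b}. ennreal (r x) \<partial>lebesgue)
    \<le> (SUP x\<in>{a<..<b}. ennreal (LINT t:{a<..<x}|lebesgue. r t))"
proof -
  \<comment> \<open>The shift by 2 starts the sequence at the midpoint; a shift by 1 would give
    \<open>u 0 = a\<close>, outside the open interval.\<close>
  define u where "u n = b - (b - a) / (real n + 2)" for n
  have u: "u n \<in> {a<..<b}" for n
  proof -
    have "(b - a) * 1 < (b - a) * (real n + 2)"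
      using assms(1) by (intro mult_strict_left_mono) auto
    then show ?thesis
      using assms(1) by (simp add: u_def field_simps)
  qed
  have mono_u: "u i \<le> u j" if "i \<le> j" for i j
    using assms(1) that by (auto simp: u_def intro!: divide_left_mono)
  have lim: "u \<longlonglongrightarrow> b"
    unfolding u_def by real_asymp
  let ?g = "\<lambda>n x. ennreal (r x) * indicator {a<..<u n} x"
  have g_eq: "?g n = (\<lambda>x. ennreal (indicator {a<..<u n} x *\<^sub>R r x))" for n
    by (auto simp: indicator_def)
  have int: "integrable lebesgue (\<lambda>x. indicator {a<..<u n} x *\<^sub>R r x)" for n
    using r[OF u] by (simp add: set_integrable_def)
  have g_int: "(\<integral>\<^sup>+x. ?g n x \<partial>lebesgue) = ennreal (LINT t:{a<..<u n}|lebesgue. r t)" for n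
  proof -
    have "0 \<le> indicator {a<..<u n} x *\<^sub>R r x" for x
      using nonneg[of x] u[of n] by (auto simp: indicator_def)
    then show ?thesis
      unfolding g_eq set_lebesgue_integral_def by (intro nn_integral_eq_integral int) auto
  qed
  \<comment> \<open>Each point of the interval lies below some \<open>u n\<close>, where the
    truncation already agrees with \<open>r\<close>.\<close>
  have "ennreal (r x) * indicator {a<..<b} x \<le> (SUP n. ?g n x)" for x
  proof (cases "x \<in> {a<..<b}")
    case True
    then obtain n where "x < u n"
      using order_tendstoD(1)[OF lim, of x] by (auto simp: eventually_sequentially)
    with True have "ennreal (r x) * indicator {a<..<b} x = ?g n x"
      by (auto simp: indicator_def)
    also have "\<dots> \<le> (SUP n. ?g n x)" by (rule SUP_upper) simp
    finally show ?thesis .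
  qed auto
  then have "(\<integral>\<^sup>+x\<in>{a<..<b}. ennreal (r x) \<partial>lebesgue) \<le> (\<integral>\<^sup>+x. (SUP n. ?g n x) \<partial>lebesgue)"
    by (intro nn_integral_mono)
  also have "\<dots> = (SUP n. \<integral>\<^sup>+x. ?g n x \<partial>lebesgue)"
  proof (rule nn_integral_monotone_convergence_SUP)
    show "incseq ?g"
    proof (intro incseq_SucI le_funI)
      fix n x
      show "?g n x \<le> ?g (Suc n) x"
        using mono_u[of n "Suc n"] by (auto simp: indicator_def)
    qed
    show "?g n \<in> borel_measurable lebesgue" for n
      unfolding g_eq using borel_measurable_integrable[OF int] by measurable
  qed
  also have "\<dots> \<le> (SUP x\<in>{a<..<b}. ennreal (LINT t:{a<..<x}|lebesgue. r t))"
    unfolding g_int by (intro SUP_least SUP_upper u)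
  finally show ?thesis .
qed

theorem theorem2p12:
  fixes a b :: real and r f :: "real \<Rightarrow> real" and p :: nat
  assumes "a < b"
    and "continuous_on {a<..<b} r"
    and "\<And>x. x \<in> {a<..<b} \<Longrightarrow> 0 < r x"
    and "0 < p"
    and "f \<in> borel_measurable (lebesgue_on {a<..<b})"
    and "\<And>x. x \<in> {a<..<b} \<Longrightarrow> 0 \<le> f x"
    and "\<And>x. x \<in> {a<..<b} \<Longrightarrow> set_integrable lebesgue {a<..<x} r"
    and "\<And>x. x \<in> {a<..<b} \<Longrightarrow> set_integrable lebesgue {x<..<b} f"
    and "set_integrable lebesgue {a<..<b} (\<lambda>x. f x ^ (p + 1))"
    and "set_integrable lebesgue {a<..<b}
           (\<lambda>x. r x * (LINT t:{x<..<b}|lebesgue. f t) ^ (p + 1))"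
  shows "ennreal (LINT x:{a<..<b}|lebesgue. r x * (LINT t:{x<..<b}|lebesgue. f t) ^ (p + 1))
    \<le> ennreal ((b - a) ^ p)
       * (SUP x\<in>{a<..<b}. ennreal (LINT t:{a<..<x}|lebesgue. r t))
       * ennreal (LINT x:{a<..<b}|lebesgue. f x ^ (p + 1))"
proof -
  define F where "F x = (LINT t:{x<..<b}|lebesgue. f t)" for x
  define I where "I = (LINT x:{a<..<b}|lebesgue. f x ^ (p + 1))"
  define S where "S = (SUP x\<in>{a<..<b}. ennreal (LINT t:{a<..<x}|lebesgue. r t))"
  have F_nonneg: "0 \<le> F x" if "x \<in> {a<..<b}" for x
    unfolding F_def set_lebesgue_integral_def
    by (rule integral_nonneg_AE) (use that assms(6) in \<open>auto simp: indicator_def\<close>)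
  have I_nonneg: "0 \<le> I"
    unfolding I_def set_lebesgue_integral_def
    by (rule integral_nonneg_AE) (use assms(6) in \<open>auto simp: indicator_def\<close>)
  \<comment> \<open>Jensen on \<open>{x<..<b}\<close>; since the integrand is nonnegative, enlarging
    the interval to \<open>{a<..<b}\<close> only increases both factors. The bound is free of
    \<open>x\<close>.\<close>
  have F_le: "F x ^ (p + 1) \<le> (b - a) ^ p * I" if x: "x \<in> {a<..<b}" for x
  proof -
    have fp: "set_integrable lebesgue {x<..<b} (\<lambda>t. f t ^ (p + 1))"
      by (rule set_integrable_subset[OF assms(9)]) (use x in auto)
    have le: "(LINT t:{x<..<b}|lebesgue. f t ^ (p + 1)) \<le> I"
      unfolding I_def set_lebesgue_integral_def
      using fp assms(9) x assms(6)
      by (intro integral_mono) (auto simp: set_integrable_def indicator_def)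
    have "F x ^ (p + 1) \<le> (b - x) ^ p * (LINT t:{x<..<b}|lebesgue. f t ^ (p + 1))"
      using set_integral_power_Suc_le[of x b f p] x assms(6,8) fp by (simp add: F_def)
    also have "\<dots> \<le> (b - x) ^ p * I"
      using le x by (intro mult_left_mono) auto
    also have "\<dots> \<le> (b - a) ^ p * I"
      using x I_nonneg by (intro mult_right_mono power_mono) auto
    finally show ?thesis .
  qed
  \<comment> \<open>Continuity on the open interval makes the extension of \<open>r\<close> by zero
    Borel measurable, which later allows a constant to be pulled out of the integral.\<close>
  have r_meas: "(\<lambda>x. ennreal (r x) * indicator {a<..<b} x) \<in> borel_measurable lebesgue"
  proof -
    have "(\<lambda>x. indicator {a<..<b} x *\<^sub>R r x) \<in> borel_measurable borel"
      using assms(2) by (intro borel_measurable_continuous_on_indicator) auto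
    then have "(\<lambda>x. indicator {a<..<b} x *\<^sub>R r x) \<in> borel_measurable lebesgue"
      by (simp add: measurable_completion)
    then have "(\<lambda>x. ennreal (indicator {a<..<b} x *\<^sub>R r x)) \<in> borel_measurable lebesgue"
      by measurable
    also have "(\<lambda>x. ennreal (indicator {a<..<b} x *\<^sub>R r x)) = (\<lambda>x. ennreal (r x) * indicator {a<..<b} x)"
      by (auto simp: indicator_def)
    finally show ?thesis .
  qed
  have "0 \<le> indicator {a<..<b} x *\<^sub>R (r x * F x ^ (p + 1))" for x
    using assms(3)[of x] F_nonneg[of x] by (auto simp: indicator_def)
  \<comment> \<open>The passage to the extended integral comes before the bound, because
    \<open>r\<close> itself may have infinite integral over \<open>{a<..<b}\<close>.\<close>
  then have "ennreal (LINT x:{a<..<b}|lebesgue. r x * F x ^ (p + 1))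
      = (\<integral>\<^sup>+x. ennreal (indicator {a<..<b} x *\<^sub>R (r x * F x ^ (p + 1))) \<partial>lebesgue)"
    using assms(10) unfolding set_lebesgue_integral_def set_integrable_def F_def
    by (intro nn_integral_eq_integral[symmetric]) auto
  also have "\<dots> \<le> (\<integral>\<^sup>+x. (ennreal (r x) * indicator {a<..<b} x) * ennreal ((b - a) ^ p * I) \<partial>lebesgue)"
  proof (rule nn_integral_mono)
    fix x
    show "ennreal (indicator {a<..<b} x *\<^sub>R (r x * F x ^ (p + 1)))
      \<le> (ennreal (r x) * indicator {a<..<b} x) * ennreal ((b - a) ^ p * I)"
    proof (cases "x \<in> {a<..<b}")
      case True
      then have "r x * F x ^ (p + 1) \<le> r x * ((b - a) ^ p * I)"
        using assms(3)[of x] F_le[of x] by (intro mult_left_mono) auto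
      with True assms(3)[of x] show ?thesis
        by (simp add: ennreal_mult'[symmetric] ennreal_leI)
    qed simp
  qed
  also have "\<dots> = (\<integral>\<^sup>+x\<in>{a<..<b}. ennreal (r x) \<partial>lebesgue) * ennreal ((b - a) ^ p * I)"
    by (rule nn_integral_multc[OF r_meas])
  also have "\<dots> \<le> S * ennreal ((b - a) ^ p * I)"
    unfolding S_def using assms(1,3,7)
    by (intro mult_right_mono nn_integral_le_SUP_set_integral) (auto intro: less_imp_le)
  also have "\<dots> = ennreal ((b - a) ^ p) * S * ennreal I"
    using assms(1) I_nonneg by (simp add: ennreal_mult mult_ac)
  finally show ?thesis by (simp only: F_def I_def S_def)
qed

end
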